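(* Let $p$ be a prime, $\ell$ a positive integer, $\mathbb{Z}_{p^\ell}=\mathbb{Z}/p^\ell\mathbb{Z}$, $d\ge1$, $w\in\mathbb{R}^n$ a weight vector, and $\prec$ a monomial order for $\mathbb{Z}_{p^\ell}[x_1,\ldots,x_n]$. Let $f\in\mathbb{Z}_{p^\ell}[x_1,\ldots,x_n]^d$ be a homogeneous element and let $S=\{g_1,\ldots,g_s\}$ be a set of homogeneous elements of $\mathbb{Z}_{p^\ell}[x_1,\ldots,x_n]^d$. Then the division algorithm for modules written out in the context, applied to $f$ and $g_1,\ldots,g_s$, computes (in particular, it terminates with) $r\in\mathbb{Z}_{p^\ell}[x_1,\ldots,x_n]^d$ and $h_1,\ldots,h_s\in\mathbb{Z}_{p^\ell}[x_1,\ldots,x_n]$ such that $$f=\sum_{i=1}^{s}h_ig_i+r,$$ where $\operatorname{in}_{w,\prec}(r)\ge\operatorname{in}_{w,\prec}(f)$, $\operatorname{in}_{w,\prec}(h_ig_i)\ge\operatorname{in}_{w,\prec}(f)$ for every $i\in\{1,\ldots,s\}$, and no term of $r$ is divisible by $\operatorname{in}_{w,\prec}(g_i)$ for any $i\in\{1,\ldots,s\}$.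
   Context: Define $v:\mathbb{Z}_{p^\ell}\to\{0,1,\ldots,\ell-1,\infty\}$ by $v(m)=k$ if $m=p^ka$ with $m\ne0$ in $\mathbb{Z}_{p^\ell}$ and $\gcd(p,a)=1$, and $v(0)=\infty$. Let $e_1,\ldots,e_d$ be the standard basis. Every element of $\mathbb{Z}_{p^\ell}[x_1,\ldots,x_n]^d$ is a finite sum $f=\sum c_{u,k}x^ue_k$; its terms are the $c_{u,k}x^ue_k$ with $c_{u,k}\neq0$, the degree of such a term is $|u|=u_1+\cdots+u_n$, and $\operatorname{supp}(f)=\{(u,k):c_{u,k}\ne0\}$. An element is homogeneous if all its terms have the same degree. Monomials $x^ue_i$ are ordered by $x^ue_i\succ x^{u'}e_j$ if $x^u\succ x^{u'}$, or $x^u=x^{u'}$ and $e_i\succ e_j$, where $e_1\prec\cdots\prec e_d$. Nonzero terms are compared by: $ax^ue_i<bx^{u'}e_j$ if $v(a)+w\cdot u<v(b)+w\cdot u'$, or if $v(a)+w\cdot u=v(b)+w\cdot u'$ and $x^ue_i\succ x^{u'}e_j$; $t\ge t'$ means that $t<t'$ does not hold. For $f\ne0$, $\operatorname{in}_{w,\prec}(f)$ is the smallest term of $f$ for this comparison. By convention $\operatorname{in}_{w,\prec}(0)=0$ is larger than every nonzero term, $0\ge0$, and $0$ divides no nonzero term. A nonzero term $bx^\beta e_j$ divides a term $ax^\alpha e_i$ if $i=j$, $b$ divides $a$ in $\mathbb{Z}_{p^\ell}$, and $x^\beta$ divides $x^\alpha$; then $ax^\alpha e_i/(bx^\beta e_i)$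 denotes a term $c'x^{\alpha-\beta}$ with $c'b=a$ in $\mathbb{Z}_{p^\ell}$. For $a,b\in\mathbb{Z}_{p^\ell}[x_1,\ldots,x_n]^d$, $\operatorname{ecart}(a,b)=|\operatorname{supp}(b)\setminus\operatorname{supp}(a)|$. Division algorithm for modules. Input: $f$ and $g_1,\ldots,g_s$. Initialize $D=\{g_1,\ldots,g_s\}$, $h_1=\cdots=h_s=0$, $q=f$, $r=0$. While $q\ne0$, do the following. (1) If there is no $g\in D$ with $\operatorname{in}_{w,\prec}(g)$ dividing $\operatorname{in}_{w,\prec}(q)$: replace $D$ by $D\cup\{q\}$, then replace $r$ by $r+\operatorname{in}_{w,\prec}(q)$ and $q$ by $q-\operatorname{in}_{w,\prec}(q)$. (2) Otherwise choose $g\in D$ such that $\operatorname{in}_{w,\prec}(g)$ divides $\operatorname{in}_{w,\prec}(q)$ with $\operatorname{ecart}(g,q)$ minimal. If $\operatorname{ecart}(g,q)>0$, replace $D$ by $D\cup\{q\}$. Put $c=\operatorname{in}_{w,\prec}(q)/\operatorname{in}_{w,\prec}(g)$ and $l=q-cg$. (2a) If $g=g_k$ for some $k\in\{1,\ldots,s\}$: replace $q$ by $l$ and $h_k$ by $h_k+c$, leaving $h_i$ ($i\ne k$) and $r$ unchanged. (2b) Otherwise $g=q_m$ is the value of $q$ at some earlier iteration $m$, at which it was put into $D$; let $h_{k,m}$ and $r_m$ be the corresponding values of $h_k$ and $r$, so that $f=q_m+\sum_{k}h_{k,m}g_k+r_m$. Replace $q$ by $\frac{1}{1-c}\,l$,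 each $h_k$ by $\frac{1}{1-c}(h_k-c\,h_{k,m})$, and $r$ by $\frac{1}{1-c}(r-c\,r_m)$, where $\frac1{1-c}$ is the inverse of $1-c$ in $\mathbb{Z}_{p^\ell}$. When $q=0$, return $r$ (together with $h_1,\ldots,h_s$). *)

theory Defs
  imports
    "HOL-Analysis.Analysis"
    "HOL-Library.Poly_Mapping"
    "Berlekamp_Zassenhaus.Finite_Field"
begin

text \<open>
  The ring of integers modulo \<open>p ^ l\<close> is \<open>'a mod_ring\<close> for a type \<open>'a\<close> with \<open>CARD('a) = p ^ l\<close>; the
  finite type \<open>'n\<close> indexes the variables, and the finite linearly ordered type \<open>'d\<close> indexes the
  standard basis, its order being the one of the \<open>e\<^sub>k\<close>.
\<close>

type_synonym 'n expo = "'n \<Rightarrow>\<^sub>0 nat"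
type_synonym ('a, 'n) mpoly = "'n expo \<Rightarrow>\<^sub>0 'a mod_ring"
type_synonym ('a, 'n, 'd) mvec = "(('n \<Rightarrow>\<^sub>0 nat) \<Rightarrow>\<^sub>0 'a mod_ring, 'd) vec"

text \<open>A triple \<open>(c, u, k)\<close> stands for the term \<open>c x\<^sup>u e\<^sub>k\<close>.\<close>

type_synonym ('a, 'n, 'd) mterm = "'a mod_ring \<times> 'n expo \<times> 'd"

text \<open>The number \<open>k\<close> below is unique if \<open>CARD('a) = p ^ l\<close> for a prime \<open>p\<close>, since \<open>m \<noteq> 0\<close>.\<close>

definition val :: "nat \<Rightarrow> 'a::nontriv mod_ring \<Rightarrow> ereal" where
  "val p m = (if m = 0 then \<infinity>
     else ereal (real (THE k. \<exists>a::int. coprime (int p) a \<and> m = of_int (int p ^ k * a))))"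

definition expo_deg :: "'n::finite expo \<Rightarrow> nat" where
  "expo_deg u = (\<Sum>i\<in>UNIV. Poly_Mapping.lookup u i)"

definition wdot :: "real ^ 'n \<Rightarrow> 'n::finite expo \<Rightarrow> real" where
  "wdot w u = w \<bullet> (\<chi> i. real (Poly_Mapping.lookup u i))"

definition supp :: "('a::nontriv, 'n, 'd::finite) mvec \<Rightarrow> ('n expo \<times> 'd) set" where
  "supp f = {(u, k). Poly_Mapping.lookup (f $ k) u \<noteq> 0}"

definition mterms :: "('a::nontriv, 'n, 'd::finite) mvec \<Rightarrow> ('a, 'n, 'd) mterm set" where
  "mterms f = {(c, u, k). c = Poly_Mapping.lookup (f $ k) u \<and> c \<noteq> 0}"

definition homogeneous :: "('a::nontriv, 'n::finite, 'd::finite) mvec \<Rightarrow> bool" where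
  "homogeneous f \<longleftrightarrow> (\<exists>m. \<forall>(c, u, k)\<in>mterms f. expo_deg u = m)"

text \<open>\<open>prec u u'\<close> is to be read as \<open>x\<^sup>u \<prec> x\<^sup>u\<^sup>'\<close>.\<close>

definition monomial_order :: "('n expo \<Rightarrow> 'n expo \<Rightarrow> bool) \<Rightarrow> bool" where
  "monomial_order prec \<longleftrightarrow>
     irreflp prec \<and> transp prec \<and> totalp prec \<and>
     (\<forall>u. u \<noteq> 0 \<longrightarrow> prec 0 u) \<and>
     (\<forall>u u' v. prec u u' \<longrightarrow> prec (u + v) (u' + v))"

definition prec_mod ::
  "('n expo \<Rightarrow> 'n expo \<Rightarrow> bool) \<Rightarrow> 'n expo \<times> 'd::linorder \<Rightarrow> 'n expo \<times> 'd \<Rightarrow> bool" where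
  "prec_mod prec = (\<lambda>(u, i) (u', j). prec u u' \<or> u = u' \<and> i < j)"

text \<open>For equal weights the term with the larger monomial is the smaller one.\<close>

definition term_less ::
  "nat \<Rightarrow> real ^ 'n \<Rightarrow> ('n expo \<Rightarrow> 'n expo \<Rightarrow> bool) \<Rightarrow>
   ('a::nontriv, 'n::finite, 'd::linorder) mterm \<Rightarrow> ('a, 'n, 'd) mterm \<Rightarrow> bool" where
  "term_less p w prec = (\<lambda>(a, u, i) (b, u', j).
     val p a + ereal (wdot w u) < val p b + ereal (wdot w u') \<or>
     val p a + ereal (wdot w u) = val p b + ereal (wdot w u') \<and> prec_mod prec (u', j) (u, i))"

text \<open>
  Initial terms are of type \<open>mterm option\<close>, the initial term \<open>0\<close> of the zero vector being \<open>None\<close>.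
  The three functions below implement the conventions for \<open>0\<close>: it is larger than every nonzero
  term, and it divides no nonzero term.
\<close>

definition in_term ::
  "nat \<Rightarrow> real ^ 'n \<Rightarrow> ('n expo \<Rightarrow> 'n expo \<Rightarrow> bool) \<Rightarrow>
   ('a::nontriv, 'n::finite, 'd::{finite,linorder}) mvec \<Rightarrow> ('a, 'n, 'd) mterm option" where
  "in_term p w prec f = (if f = 0 then None
     else Some (THE t. t \<in> mterms f \<and> (\<forall>t'\<in>mterms f - {t}. term_less p w prec t t')))"

fun in_less ::
  "nat \<Rightarrow> real ^ 'n \<Rightarrow> ('n expo \<Rightarrow> 'n expo \<Rightarrow> bool) \<Rightarrow>
   ('a::nontriv, 'n::finite, 'd::linorder) mterm option \<Rightarrow> ('a, 'n, 'd) mterm option \<Rightarrow> bool" where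
  "in_less p w prec (Some t) (Some t') = term_less p w prec t t'"
| "in_less p w prec (Some t) None = True"
| "in_less p w prec None t' = False"

definition in_ge ::
  "nat \<Rightarrow> real ^ 'n \<Rightarrow> ('n expo \<Rightarrow> 'n expo \<Rightarrow> bool) \<Rightarrow>
   ('a::nontriv, 'n::finite, 'd::linorder) mterm option \<Rightarrow> ('a, 'n, 'd) mterm option \<Rightarrow> bool" where
  "in_ge p w prec t t' \<longleftrightarrow> \<not> in_less p w prec t t'"

fun in_dvd ::
  "('a::nontriv, 'n, 'd) mterm option \<Rightarrow> ('a, 'n, 'd) mterm option \<Rightarrow> bool" where
  "in_dvd (Some (b, \<beta>, j)) (Some (a, \<alpha>, i)) \<longleftrightarrow> i = j \<and> b dvd a \<and> (\<exists>\<gamma>. \<alpha> = \<beta> + \<gamma>)"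
| "in_dvd _ _ \<longleftrightarrow> False"

fun in_vec :: "('a::nontriv, 'n, 'd::finite) mterm option \<Rightarrow> ('a, 'n, 'd) mvec" where
  "in_vec (Some (c, u, k)) = axis k (Poly_Mapping.single u c)"
| "in_vec None = 0"

text \<open>
  Over a ring with zero divisors the quotient of two terms is not unique, hence a relation:
  \<open>is_quotient t t' c\<close> says that \<open>c\<close> is a possible value of \<open>t / t'\<close>.
\<close>

definition is_quotient ::
  "('a::nontriv, 'n, 'd) mterm option \<Rightarrow> ('a, 'n, 'd) mterm option \<Rightarrow> ('a, 'n) mpoly \<Rightarrow> bool" where
  "is_quotient t t' c \<longleftrightarrow>
     (\<exists>a \<alpha> b \<beta> i c'. t = Some (a, \<alpha>, i) \<and> t' = Some (b, \<beta>, i) \<and> in_dvd t' t \<and>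
        c' * b = a \<and> c = Poly_Mapping.single (\<alpha> - \<beta>) c')"

definition ecart ::
  "('a::nontriv, 'n, 'd::finite) mvec \<Rightarrow> ('a, 'n, 'd) mvec \<Rightarrow> nat" where
  "ecart a b = card (supp b - supp a)"

text \<open>
  A state of the algorithm holds the current values of \<open>q\<close>, \<open>h\<close>, \<open>r\<close> and, in \<open>stored\<close>, the triples
  \<open>(q\<^sub>m, h\<^sub>m, r\<^sub>m)\<close> of the iterations \<open>m\<close> at which \<open>q\<^sub>m\<close> was put into \<open>D\<close>, with values taken before the
  updates of that iteration. Only the values of \<open>h\<close> at \<open>1, \<dots>, s\<close> matter.
\<close>

record ('a, 'n, 'd) div_state =
  qpart :: "('a, 'n, 'd) mvec"
  hpart :: "nat \<Rightarrow> ('a, 'n) mpoly"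
  rpart :: "('a, 'n, 'd) mvec"
  stored :: "(('a, 'n, 'd) mvec \<times> (nat \<Rightarrow> ('a, 'n) mpoly) \<times> ('a, 'n, 'd) mvec) set"

definition div_init :: "('a::nontriv, 'n, 'd::finite) mvec \<Rightarrow> ('a, 'n, 'd) div_state" where
  "div_init f = \<lparr>qpart = f, hpart = (\<lambda>_. 0), rpart = 0, stored = {}\<rparr>"

definition divisor_set ::
  "nat \<Rightarrow> (nat \<Rightarrow> ('a::nontriv, 'n, 'd::finite) mvec) \<Rightarrow> ('a, 'n, 'd) div_state \<Rightarrow>
   ('a, 'n, 'd) mvec set" where
  "divisor_set s g \<sigma> = g ` {1..s} \<union> fst ` stored \<sigma>"

definition put_current ::
  "('a::nontriv, 'n, 'd::finite) div_state \<Rightarrow>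
   (('a, 'n, 'd) mvec \<times> (nat \<Rightarrow> ('a, 'n) mpoly) \<times> ('a, 'n, 'd) mvec) set" where
  "put_current \<sigma> = insert (qpart \<sigma>, hpart \<sigma>, rpart \<sigma>) (stored \<sigma>)"

definition candidate ::
  "nat \<Rightarrow> real ^ 'n \<Rightarrow> ('n expo \<Rightarrow> 'n expo \<Rightarrow> bool) \<Rightarrow> nat \<Rightarrow>
   (nat \<Rightarrow> ('a::nontriv, 'n::finite, 'd::{finite,linorder}) mvec) \<Rightarrow>
   ('a, 'n, 'd) div_state \<Rightarrow> ('a, 'n, 'd) mvec \<Rightarrow> bool" where
  "candidate p w prec s g \<sigma> b \<longleftrightarrow>
     b \<in> divisor_set s g \<sigma> \<and> in_dvd (in_term p w prec b) (in_term p w prec (qpart \<sigma>))"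

text \<open>The choices of an iteration entering step (2): a divisor of minimal ecart and a quotient.\<close>

definition choice ::
  "nat \<Rightarrow> real ^ 'n \<Rightarrow> ('n expo \<Rightarrow> 'n expo \<Rightarrow> bool) \<Rightarrow> nat \<Rightarrow>
   (nat \<Rightarrow> ('a::nontriv, 'n::finite, 'd::{finite,linorder}) mvec) \<Rightarrow>
   ('a, 'n, 'd) div_state \<Rightarrow> ('a, 'n, 'd) mvec \<Rightarrow> ('a, 'n) mpoly \<Rightarrow> bool" where
  "choice p w prec s g \<sigma> b c \<longleftrightarrow>
     candidate p w prec s g \<sigma> b \<and>
     (\<forall>b'. candidate p w prec s g \<sigma> b' \<longrightarrow> ecart b (qpart \<sigma>) \<le> ecart b' (qpart \<sigma>)) \<and>
     is_quotient (in_term p w prec (qpart \<sigma>)) (in_term p w prec b) c"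

definition stored_after ::
  "('a::nontriv, 'n, 'd::finite) div_state \<Rightarrow> ('a, 'n, 'd) mvec \<Rightarrow>
   (('a, 'n, 'd) mvec \<times> (nat \<Rightarrow> ('a, 'n) mpoly) \<times> ('a, 'n, 'd) mvec) set" where
  "stored_after \<sigma> b = (if ecart b (qpart \<sigma>) > 0 then put_current \<sigma> else stored \<sigma>)"

text \<open>
  \<open>inverse_one_minus c v\<close>: the polynomial \<open>c\<close> is a constant and \<open>v\<close> is the (constant polynomial of the)
  inverse of \<open>1 - c\<close> in the coefficient ring.
\<close>

definition inverse_one_minus ::
  "('a::nontriv, 'n) mpoly \<Rightarrow> ('a, 'n) mpoly \<Rightarrow> bool" where
  "inverse_one_minus c v \<longleftrightarrow>
     (\<exists>c0 v0. c = Poly_Mapping.single 0 c0 \<and> v = Poly_Mapping.single 0 v0 \<and> v0 * (1 - c0) = 1)"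

text \<open>
  One iteration of the algorithm, for all possible choices. The successor \<open>None\<close> means that the
  iteration asks for an inverse of \<open>1 - c\<close> that does not exist.
\<close>

inductive div_step ::
  "nat \<Rightarrow> real ^ 'n \<Rightarrow> ('n expo \<Rightarrow> 'n expo \<Rightarrow> bool) \<Rightarrow> nat \<Rightarrow>
   (nat \<Rightarrow> ('a::nontriv, 'n::finite, 'd::{finite,linorder}) mvec) \<Rightarrow>
   ('a, 'n, 'd) div_state option \<Rightarrow> ('a, 'n, 'd) div_state option \<Rightarrow> bool"
  for p w prec s g where
  step_1:
    "div_step p w prec s g (Some \<sigma>) (Some
       \<lparr>qpart = qpart \<sigma> - in_vec (in_term p w prec (qpart \<sigma>)),
        hpart = hpart \<sigma>,
        rpart = rpart \<sigma> + in_vec (in_term p w prec (qpart \<sigma>)),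
        stored = put_current \<sigma>\<rparr>)"
    if "qpart \<sigma> \<noteq> 0" and "\<nexists>b. candidate p w prec s g \<sigma> b"
| step_2a:
    "div_step p w prec s g (Some \<sigma>) (Some
       \<lparr>qpart = qpart \<sigma> - c *s g k,
        hpart = (hpart \<sigma>)(k := hpart \<sigma> k + c),
        rpart = rpart \<sigma>,
        stored = stored_after \<sigma> (g k)\<rparr>)"
    if "qpart \<sigma> \<noteq> 0" and "k \<in> {1..s}" and "choice p w prec s g \<sigma> (g k) c"
| step_2b:
    "div_step p w prec s g (Some \<sigma>) (Some
       \<lparr>qpart = v *s (qpart \<sigma> - c *s qm),
        hpart = (\<lambda>k. v * (hpart \<sigma> k - c * hm k)),
        rpart = v *s (rpart \<sigma> - c *s rm),
        stored = stored_after \<sigma> qm\<rparr>)"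
    if "qpart \<sigma> \<noteq> 0" and "qm \<notin> g ` {1..s}" and "(qm, hm, rm) \<in> stored \<sigma>"
      and "choice p w prec s g \<sigma> qm c" and "inverse_one_minus c v"
| step_2b_undefined:
    "div_step p w prec s g (Some \<sigma>) None"
    if "qpart \<sigma> \<noteq> 0" and "b \<notin> g ` {1..s}"
      and "choice p w prec s g \<sigma> b c" and "\<nexists>v. inverse_one_minus c v"

end

theory Submission
  imports Defs
begin

text \<open>
  Every iteration replaces \<open>q\<close> by a vector all of whose terms are strictly larger than the initial
  term of \<open>q\<close>: the initial term cancels, the other terms of \<open>q\<close> and of the multiple of the divisor
  are larger, and a sum of two coefficients has at least the smaller of the two valuations
  (\<open>quotient_mult\<close>). By homogeneity all the vectors \<open>q\<close> have terms of one degree \<open>m\<close> only, and since the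
  coefficient ring is finite there are only finitely many such terms. So the initial terms of the
  successive \<open>q\<close> form a strictly increasing sequence in a finite set, and the algorithm stops
  (\<open>no_infinite_run\<close>).

  The same two facts make step (2b) possible. A stored vector \<open>q'\<close> has the same degree as \<open>q\<close>, so if its
  initial term divides that of \<open>q\<close>, then both have the same monomial and the quotient \<open>c\<close> is a constant.
  Since the initial term of \<open>q'\<close> is strictly smaller, its coefficient has a strictly smaller valuation;
  hence \<open>c\<close> has positive valuation and \<open>1 - c\<close> is a unit (\<open>stored_quotient_const\<close>).

  The identity for \<open>f\<close> and the lower bounds for the terms hold for all triples \<open>(q, h, r)\<close> that occur,
  because they are preserved by the combinations of step (2b), see \<open>partial_division_combine\<close>. The delicate
  point is the remainder, since a combination \<open>(r - c r') / (1 - c)\<close> changes its coefficients after their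
  terms have been found indivisible. What saves it is that divisibility of terms depends on
  coefficients only through their valuations, and these do not change any more: once a coefficient of
  the remainder is nonzero, its valuation is the same in all later remainders. For step (2b), a
  coefficient of \<open>r'\<close> is zero or has the valuation of the corresponding coefficient of \<open>r\<close>, and the factor \<open>c\<close>
  of positive valuation makes the correction too small to be seen. For step (1), the added term
  is larger than all terms of \<open>r\<close>. This is the content of \<open>division_invariant\<close>, which holds initially and is
  preserved by every iteration (\<open>div_step_invariant\<close>).
\<close>

section \<open>Valuations on the integers modulo a prime power\<close>

lemma of_int_mod_ring_eq_0_iff:
  "(of_int x :: 'a::nontriv mod_ring) = 0 \<longleftrightarrow> int CARD('a) dvd x"
  unfolding of_int_of_int_mod_ring by transfer (rule mod_eq_0_iff_dvd)

lemma mod_ring_of_int_surj: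
  fixes a :: "'a::nontriv mod_ring"
  obtains x where "a = of_int x"
  using that[of "to_int_mod_ring a"] by (simp add: of_int_of_int_mod_ring)

text \<open>
  The argument \<open>ring_type\<close> only fixes the type \<open>'a\<close>, on which the assumption on \<open>CARD('a)\<close> depends.
\<close>

locale prime_power_modulus =
  fixes p l :: nat and ring_type :: "'a::nontriv itself"
  assumes prime_p: "prime p" and card_ring: "CARD('a) = p ^ l"
begin

lemma of_int_eq_0_iff: "(of_int x :: 'a mod_ring) = 0 \<longleftrightarrow> int p ^ l dvd x"
  by (simp add: of_int_mod_ring_eq_0_iff card_ring)

lemma prime_int_p: "prime (int p)"
  using prime_p by simp

lemma prime_power_factorization:
  fixes a :: "'a mod_ring"
  assumes "a \<noteq> 0"
  obtains k x where "k < l" "coprime (int p) x" "a = of_int (int p ^ k * x)"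
proof -
  obtain y where y: "a = of_int y" by (rule mod_ring_of_int_surj)
  have ndvd: "\<not> int p ^ l dvd y"
    using assms y of_int_eq_0_iff[of y] by simp
  then have "y \<noteq> 0" by auto
  moreover have "\<not> is_unit (int p)"
    using prime_int_p not_prime_unit by blast
  ultimately obtain x where x: "y = int p ^ multiplicity (int p) y * x" "\<not> int p dvd x"
    by (rule multiplicity_decompose')
  have "multiplicity (int p) y < l"
    using ndvd multiplicity_dvd'[of l "int p" y] by fastforce
  moreover have "coprime (int p) x"
    using prime_int_p x(2) by (simp add: prime_imp_coprime)
  ultimately show ?thesis
    using that[of "multiplicity (int p) y" x] x(1) y by simp
qed

text \<open>
  This makes the exponent in \<open>val\<close> unique: if \<open>i < j\<close>, then \<open>p ^ (i + 1)\<close> would divide the right-hand side, and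
  it divides the modulus because \<open>i < l\<close>, so that \<open>p\<close> would divide \<open>x\<close>.
\<close>

lemma prime_power_exponent_le:
  assumes nz: "(of_int (int p ^ i * x) :: 'a mod_ring) \<noteq> 0"
    and eq: "(of_int (int p ^ i * x) :: 'a mod_ring) = of_int (int p ^ j * y)"
    and cop: "coprime (int p) x"
  shows "j \<le> i"
proof (rule ccontr)
  assume "\<not> j \<le> i"
  have "\<not> int p ^ l dvd int p ^ i * x"
    using nz of_int_eq_0_iff[of "int p ^ i * x"] by simp
  then have "i < l"
    using le_imp_power_dvd[of l i "int p"] dvd_mult2 by (metis not_less)
  have "(of_int (int p ^ i * x - int p ^ j * y) :: 'a mod_ring) = 0"
    using eq by simp
  then have "int p ^ l dvd int p ^ i * x - int p ^ j * y"
    by (simp only: of_int_eq_0_iff)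
  moreover have "int p ^ Suc i dvd int p ^ l"
    using \<open>i < l\<close> by (intro le_imp_power_dvd) simp
  ultimately have "int p ^ Suc i dvd int p ^ i * x - int p ^ j * y"
    by (rule dvd_trans[rotated])
  moreover have "int p ^ Suc i dvd int p ^ j * y"
    using \<open>\<not> j \<le> i\<close> by (intro dvd_mult2 le_imp_power_dvd) simp
  ultimately have "int p ^ Suc i dvd int p ^ i * x"
    using dvd_add[of "int p ^ Suc i" "int p ^ i * x - int p ^ j * y" "int p ^ j * y"] by simp
  then have "int p ^ i * int p dvd int p ^ i * x"
    by (simp only: power_Suc2)
  then have "int p dvd x"
    using prime_p by (simp add: prime_gt_0_nat)
  then show False
    using cop prime_int_p coprime_common_divisor[of "int p" x "int p"] not_prime_unit[of "int p"] by simp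
qed

lemma val_eqI:
  assumes "a \<noteq> 0" "coprime (int p) x" "(a :: 'a mod_ring) = of_int (int p ^ k * x)"
  shows "val p a = ereal (real k)"
proof -
  have "(THE k. \<exists>x. coprime (int p) x \<and> a = of_int (int p ^ k * x)) = k"
  proof (rule the_equality)
    show "\<exists>x. coprime (int p) x \<and> a = of_int (int p ^ k * x)"
      using assms by (intro exI[of _ x]) simp
  next
    fix j assume "\<exists>y. coprime (int p) y \<and> a = of_int (int p ^ j * y)"
    then obtain y where "coprime (int p) y" "a = of_int (int p ^ j * y)"
      by blast
    then show "j = k"
      using assms prime_power_exponent_le[of k x j y] prime_power_exponent_le[of j y k x] by (metis antisym)
  qed
  then show ?thesis
    using assms by (simp add: val_def)
qed

lemma val_0 [simp]: "val p (0 :: 'a mod_ring) = \<infinity>"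
  by (simp add: val_def)

lemma val_cases:
  fixes a :: "'a mod_ring"
  assumes "a \<noteq> 0"
  obtains k x where "k < l" "coprime (int p) x" "a = of_int (int p ^ k * x)" "val p a = ereal (real k)"
proof -
  obtain k x where "k < l" "coprime (int p) x" "a = of_int (int p ^ k * x)"
    using assms by (rule prime_power_factorization)
  then show ?thesis
    using that[of k x] val_eqI[OF assms, of x k] by simp
qed

lemma val_finite: "a \<noteq> 0 \<Longrightarrow> val p (a :: 'a mod_ring) < \<infinity>"
  by (erule val_cases) simp

lemma val_nonneg: "val p (a :: 'a mod_ring) \<ge> 0"
proof (cases "a = 0")
  case False
  then show ?thesis
    by (rule val_cases) simp
qed simp

text \<open>
  The valuation is multiplicative only where the product does not vanish: otherwise the left-hand side is
  \<open>\<infinity>\<close> while the right-hand side may be finite.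
\<close>

lemma val_mult:
  fixes a b :: "'a mod_ring"
  assumes "a * b \<noteq> 0"
  shows "val p (a * b) = val p a + val p b"
proof -
  have "a \<noteq> 0" "b \<noteq> 0"
    using assms by auto
  obtain i x where a: "i < l" "coprime (int p) x" "a = of_int (int p ^ i * x)" "val p a = ereal (real i)"
    using \<open>a \<noteq> 0\<close> by (rule val_cases)
  obtain j y where b: "j < l" "coprime (int p) y" "b = of_int (int p ^ j * y)" "val p b = ereal (real j)"
    using \<open>b \<noteq> 0\<close> by (rule val_cases)
  have ab: "a * b = of_int (int p ^ (i + j) * (x * y))"
    by (simp add: a(3) b(3) power_add algebra_simps)
  show ?thesis
    using val_eqI[OF assms _ ab] a b by simp
qed

lemma val_add:
  fixes a b :: "'a mod_ring"
  shows "min (val p a) (val p b) \<le> val p (a + b)"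
proof -
  have *: "val p a \<le> val p (a + b)" if "val p a \<le> val p b" for a b :: "'a mod_ring"
  proof (cases "a = 0 \<or> b = 0 \<or> a + b = 0")
    case True
    then show ?thesis
      using that by auto
  next
    case False
    then have "a \<noteq> 0" "b \<noteq> 0" "a + b \<noteq> 0"
      by auto
    obtain i x where a: "i < l" "coprime (int p) x" "a = of_int (int p ^ i * x)" "val p a = ereal (real i)"
      using \<open>a \<noteq> 0\<close> by (rule val_cases)
    obtain j y where b: "j < l" "coprime (int p) y" "b = of_int (int p ^ j * y)" "val p b = ereal (real j)"
      using \<open>b \<noteq> 0\<close> by (rule val_cases)
    obtain k z where c: "k < l" "coprime (int p) z" "a + b = of_int (int p ^ k * z)"
        "val p (a + b) = ereal (real k)"
      using \<open>a + b \<noteq> 0\<close> by (rule val_cases)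
    have "i \<le> j"
      using that a(4) b(4) by simp
    then have "int p ^ j = int p ^ i * int p ^ (j - i)"
      by (simp flip: power_add)
    then have sum: "a + b = of_int (int p ^ i * (x + int p ^ (j - i) * y))"
      unfolding a(3) b(3) by (simp only: of_int_add[symmetric] distrib_left mult.assoc)
    have "of_int (int p ^ k * z) \<noteq> (0 :: 'a mod_ring)"
      using \<open>a + b \<noteq> 0\<close> unfolding c(3) .
    then have "i \<le> k"
      using sum c(2) unfolding c(3) by (rule prime_power_exponent_le)
    then show ?thesis
      using a(4) c(4) by simp
  qed
  show ?thesis
    using *[of a b] *[of b a] by (cases "val p a \<le> val p b") (auto simp: add.commute min_def)
qed

lemma val_minus: "val p (- a :: 'a mod_ring) = val p a"
proof (cases "a = 0")
  case False
  then obtain i x where a: "i < l" "coprime (int p) x" "a = of_int (int p ^ i * x)" "val p a = ereal (real i)"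
    by (rule val_cases)
  have "- a = of_int (int p ^ i * (- x))"
    unfolding a(3) by simp
  then show ?thesis
    using val_eqI[of "- a" "- x" i] False a(2,4) by simp
qed simp

lemma val_diff:
  fixes a b :: "'a mod_ring"
  shows "min (val p a) (val p b) \<le> val p (a - b)"
  using val_add[of a "- b"] by (simp add: val_minus)

lemma val_add_eq:
  fixes a b :: "'a mod_ring"
  assumes "val p a < val p b"
  shows "val p (a + b) = val p a"
  using val_add[of a b] val_diff[of "a + b" b] assms by (auto simp: min_def split: if_splits)

lemma val_diff_eq:
  fixes a b :: "'a mod_ring"
  assumes "val p a < val p b"
  shows "val p (a - b) = val p a"
  using val_add_eq[of a "- b"] assms by (simp add: val_minus)

lemma val_1: "val p (1 :: 'a mod_ring) = 0"
  using val_eqI[of 1 1 0] by simp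

lemma val_mult_left_unit:
  fixes a u v :: "'a mod_ring"
  assumes "v * u = 1"
  shows "val p (v * a) = val p a"
proof (cases "a = 0")
  case False
  have "val p v + val p u = 0"
    using val_mult[of v u] assms val_1 by simp
  then have "val p v = 0"
    using val_nonneg[of v] val_nonneg[of u] by (simp add: add_nonneg_eq_0_iff)
  moreover have "v * a \<noteq> 0"
  proof
    assume "v * a = 0"
    then have "u * (v * a) = 0" by simp
    then have "v * u * a = 0" by (simp only: mult_ac)
    then show False using assms False by simp
  qed
  ultimately show ?thesis
    by (simp add: val_mult)
qed simp

lemma unit_if_coprime:
  assumes "coprime (int p) x"
  shows "\<exists>v. v * (of_int x :: 'a mod_ring) = 1"
proof -
  have "coprime x (int p ^ l)"
    using assms by (simp add: coprime_commute)
  then obtain y where "[x * y = 1] (mod (int p ^ l))"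
    using cong_solve_coprime_int by blast
  then have "(of_int (x * y - 1) :: 'a mod_ring) = 0"
    by (simp only: of_int_eq_0_iff cong_iff_dvd_diff)
  then have "of_int y * (of_int x :: 'a mod_ring) = 1"
    by (simp add: mult.commute)
  then show ?thesis ..
qed

text \<open>
  A nonzero coefficient is a power of \<open>p\<close> times a unit, so divisibility is a comparison of valuations.
  In particular, whether a term divides another one depends on the coefficients only through their
  valuations.
\<close>

lemma dvd_iff_val_le:
  fixes a b :: "'a mod_ring"
  shows "a dvd b \<longleftrightarrow> val p a \<le> val p b"
proof
  assume "a dvd b"
  then obtain c where c: "b = a * c" ..
  show "val p a \<le> val p b"
  proof (cases "b = 0")
    case False
    then show ?thesis
      using val_mult[of a c] c val_nonneg[of c] by (simp add: add_increasing2)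
  qed simp
next
  assume le: "val p a \<le> val p b"
  show "a dvd b"
  proof (cases "a = 0 \<or> b = 0")
    case True
    then show ?thesis
      using le val_finite[of b] by (cases "b = 0") auto
  next
    case False
    then have "a \<noteq> 0" "b \<noteq> 0"
      by auto
    obtain i x where a: "i < l" "coprime (int p) x" "a = of_int (int p ^ i * x)" "val p a = ereal (real i)"
      using \<open>a \<noteq> 0\<close> by (rule val_cases)
    obtain j y where b: "j < l" "coprime (int p) y" "b = of_int (int p ^ j * y)" "val p b = ereal (real j)"
      using \<open>b \<noteq> 0\<close> by (rule val_cases)
    obtain v where v: "v * (of_int x :: 'a mod_ring) = 1"
      using unit_if_coprime a(2) by blast
    have "i \<le> j"
      using le a(4) b(4) by simp
    then have "int p ^ j = int p ^ i * int p ^ (j - i)"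
      by (simp flip: power_add)
    then have "b = (of_int (int p ^ i) * of_int (int p ^ (j - i)) * of_int y) * (v * of_int x)"
      unfolding b(3) v by (simp only: of_int_mult mult_1_right)
    also have "\<dots> = of_int (int p ^ i * x) * (of_int (int p ^ (j - i)) * of_int y * v)"
      by (simp only: of_int_mult mult_ac)
    also have "\<dots> = a * (of_int (int p ^ (j - i)) * of_int y * v)"
      unfolding a(3) ..
    finally show ?thesis
      by (rule dvdI)
  qed
qed

lemma one_minus_unit:
  fixes c :: "'a mod_ring"
  assumes "0 < val p c"
  shows "\<exists>v. v * (1 - c) = 1"
proof -
  have "val p (1 - c) = val p (1 :: 'a mod_ring)"
    using val_diff_eq[of 1 c] assms val_1 by simp
  then have "1 - c dvd 1"
    by (simp add: dvd_iff_val_le)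
  then show ?thesis
    by (metis dvdE mult.commute)
qed

end

section \<open>Terms of vectors of polynomials\<close>

abbreviation coef :: "('a::nontriv, 'n, 'd::finite) mvec \<Rightarrow> 'd \<Rightarrow> 'n expo \<Rightarrow> 'a mod_ring" where
  "coef f k u \<equiv> Poly_Mapping.lookup (f $ k) u"

lemma mem_mterms_iff: "(c, u, k) \<in> mterms f \<longleftrightarrow> c = coef f k u \<and> c \<noteq> 0"
  by (simp add: mterms_def)

lemma mvec_eqI: "(\<And>k u. coef f k u = coef g k u) \<Longrightarrow> f = g"
  by (simp add: vec_eq_iff poly_mapping_eq_iff fun_eq_iff)

lemma finite_mterms: "finite (mterms f)"
proof -
  have "mterms f \<subseteq> (\<Union>k. (\<lambda>u. (coef f k u, u, k)) ` Poly_Mapping.keys (f $ k))"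
  proof
    fix t assume "t \<in> mterms f"
    then have "t = (coef f (snd (snd t)) (fst (snd t)), fst (snd t), snd (snd t))"
      "fst (snd t) \<in> Poly_Mapping.keys (f $ snd (snd t))"
      by (auto simp: mterms_def in_keys_iff)
    then show "t \<in> (\<Union>k. (\<lambda>u. (coef f k u, u, k)) ` Poly_Mapping.keys (f $ k))"
      by blast
  qed
  then show ?thesis
    by (rule finite_subset) simp
qed

lemma mterms_eq_empty_iff: "mterms f = {} \<longleftrightarrow> f = 0"
proof
  assume *: "mterms f = {}"
  show "f = 0"
  proof (rule mvec_eqI)
    fix k u
    show "coef f k u = coef 0 k u"
      using * mem_mterms_iff[of "coef f k u" u k f] by auto
  qed
qed (auto simp: mterms_def)

lemma lookup_single_mult_add:
  fixes c :: "'b::comm_ring_1" and P :: "'n expo \<Rightarrow>\<^sub>0 'b"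
  shows "Poly_Mapping.lookup (Poly_Mapping.single \<gamma> c * P) (\<gamma> + \<delta>) = c * Poly_Mapping.lookup P \<delta>"
  by (simp add: lookup_mult lookup_single when_mult)

lemma lookup_single_mult_nonzero:
  fixes c :: "'b::comm_ring_1" and P :: "'n expo \<Rightarrow>\<^sub>0 'b"
  assumes "Poly_Mapping.lookup (Poly_Mapping.single \<gamma> c * P) u \<noteq> 0"
  obtains \<delta> where "u = \<gamma> + \<delta>"
proof -
  have "u \<in> Poly_Mapping.keys (Poly_Mapping.single \<gamma> c * P)"
    using assms by (simp add: in_keys_iff)
  then obtain a b where "u = a + b" "a \<in> Poly_Mapping.keys (Poly_Mapping.single \<gamma> c)"
    using keys_mult by blast
  then show ?thesis
    using that by (auto split: if_splits)
qed

lemma mterms_monomial_mult: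
  assumes "(x, u, k) \<in> mterms (Poly_Mapping.single \<gamma> c *s f)"
  obtains y \<delta> where "u = \<gamma> + \<delta>" "x = c * y" "(y, \<delta>, k) \<in> mterms f"
proof -
  have x: "x = Poly_Mapping.lookup (Poly_Mapping.single \<gamma> c * f $ k) u" "x \<noteq> 0"
    using assms by (auto simp: mem_mterms_iff)
  then obtain \<delta> where \<delta>: "u = \<gamma> + \<delta>"
    using lookup_single_mult_nonzero by blast
  have "x = c * coef f k \<delta>"
    using x(1) unfolding \<delta> by (simp add: lookup_single_mult_add)
  moreover have "coef f k \<delta> \<noteq> 0"
    using calculation x(2) by auto
  ultimately show ?thesis
    using that \<delta> by (simp add: mem_mterms_iff)
qed

lemma coef_const_mult: "coef (Poly_Mapping.single 0 c *s f) k u = c * coef f k u"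
  using lookup_single_mult_add[of 0 c "f $ k" u] by simp

lemma coef_in_vec: "coef (in_vec (Some (c, u, k))) k' u' = (if k' = k \<and> u' = u then c else 0)"
  by (simp add: axis_def lookup_single when_def)

section \<open>The order on terms and initial terms\<close>

locale weighted_monomial_order = prime_power_modulus p l ring_type
  for p l :: nat and ring_type :: "'a::nontriv itself" +
  fixes w :: "real ^ 'n::finite" and prec :: "'n expo \<Rightarrow> 'n expo \<Rightarrow> bool"
  assumes monomial_order: "monomial_order prec"
begin

abbreviation tless :: "('a, 'n, 'd::linorder) mterm \<Rightarrow> ('a, 'n, 'd) mterm \<Rightarrow> bool" where
  "tless \<equiv> term_less p w prec"

abbreviation initial :: "('a, 'n, 'd::{finite,linorder}) mvec \<Rightarrow> ('a, 'n, 'd) mterm option" where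
  "initial \<equiv> in_term p w prec"

lemma prec_irrefl: "\<not> prec u u"
  and prec_trans: "prec u v \<Longrightarrow> prec v v' \<Longrightarrow> prec u v'"
  and prec_total: "u \<noteq> v \<Longrightarrow> prec u v \<or> prec v u"
  and prec_add: "prec u v \<Longrightarrow> prec (v' + u) (v' + v)"
proof -
  have *: "irreflp prec" "transp prec" "totalp prec" "\<forall>u u' v. prec u u' \<longrightarrow> prec (u + v) (u' + v)"
    using monomial_order unfolding monomial_order_def by blast+
  show "\<not> prec u u"
    using *(1) by (rule irreflpD)
  show "prec u v \<Longrightarrow> prec v v' \<Longrightarrow> prec u v'"
    using *(2) by (rule transpD)
  show "u \<noteq> v \<Longrightarrow> prec u v \<or> prec v u"
    using *(3) by (rule totalpD)
  show "prec u v \<Longrightarrow> prec (v' + u) (v' + v)"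
    using *(4) unfolding add.commute[of v'] by blast
qed

lemma prec_add_cancel:
  assumes "prec (v' + u) (v' + v)"
  shows "prec u v"
proof (rule ccontr)
  assume "\<not> prec u v"
  then have "u = v \<or> prec (v' + v) (v' + u)"
    using prec_total prec_add by blast
  then show False
    using assms prec_irrefl prec_trans by blast
qed

lemma prec_mod_irrefl: "\<not> prec_mod prec m m"
  by (cases m) (simp add: prec_mod_def prec_irrefl)

lemma prec_mod_trans: "prec_mod prec m m' \<Longrightarrow> prec_mod prec m' m'' \<Longrightarrow> prec_mod prec m m''"
  by (auto simp: prec_mod_def intro: prec_trans)

lemma prec_mod_total: "m \<noteq> m' \<Longrightarrow> prec_mod prec m m' \<or> prec_mod prec m' m"
  using prec_total[of "fst m" "fst m'"] by (cases m; cases m') (auto simp: prec_mod_def)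

lemma tless_irrefl: "\<not> tless t t"
  by (cases t) (simp add: term_less_def prec_mod_irrefl)

lemma tless_trans: "tless t t' \<Longrightarrow> tless t' t'' \<Longrightarrow> tless t t''"
  by (cases t; cases t'; cases t'') (auto simp: term_less_def intro: prec_mod_trans)

text \<open>
  Together with irreflexivity and transitivity this says that \<open>tless\<close> is a strict weak order; two terms
  are equivalent if they have the same monomial and coefficients of the same valuation.
\<close>

lemma tless_cotrans: "tless t t'' \<Longrightarrow> tless t t' \<or> tless t' t''"
proof -
  obtain a m where t: "t = (a, m)" by (cases t)
  obtain a' m' where t': "t' = (a', m')" by (cases t')
  obtain a'' m'' where t'': "t'' = (a'', m'')" by (cases t'')
  have "prec_mod prec m'' m \<Longrightarrow> prec_mod prec m' m \<or> prec_mod prec m'' m'"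
    using prec_mod_total[of m m'] prec_mod_trans[of m'' m m'] by blast
  then show "tless t t'' \<Longrightarrow> tless t t' \<or> tless t' t''"
    unfolding t t' t'' by (cases m; cases m'; cases m'') (auto simp: term_less_def)
qed

lemma tless_total: "snd t \<noteq> snd t' \<Longrightarrow> tless t t' \<or> tless t' t"
  using prec_mod_total[of "snd t" "snd t'"] by (cases t; cases t') (auto simp: term_less_def)

lemma tless_same_monomial_iff: "tless (a, u, k) (b, u, k) \<longleftrightarrow> val p a < val p b"
proof -
  have "val p a + ereal r < val p b + ereal r \<longleftrightarrow> val p a < val p b" for r
    by (cases "val p a"; cases "val p b") auto
  then show ?thesis
    by (simp add: term_less_def prec_mod_irrefl)
qed

lemma wdot_add: "wdot w (u + v) = wdot w u + wdot w v"
  by (simp add: wdot_def inner_vec_def lookup_add algebra_simps sum.distrib)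

text \<open>
  A factor that annihilates neither coefficient adds the same amount to the valuation plus weight of both
  terms, and it translates both monomials.
\<close>

lemma tless_mult_cancel:
  assumes "tless (c * a, \<gamma> + u, i) (c * b, \<gamma> + v, j)" "c * a \<noteq> 0" "c * b \<noteq> 0"
  shows "tless (a, u, i) (b, v, j)"
proof -
  have "c \<noteq> 0" "a \<noteq> 0" "b \<noteq> 0"
    using assms by auto
  moreover have "\<exists>k. val p x = ereal k" if "x \<noteq> 0" for x :: "'a mod_ring"
    using val_finite[OF that] val_nonneg[of x] by (cases "val p x") auto
  ultimately obtain kc ka kb where k: "val p c = ereal kc" "val p a = ereal ka" "val p b = ereal kb"
    by metis
  have "prec_mod prec (\<gamma> + v, j) (\<gamma> + u, i) \<Longrightarrow> prec_mod prec (v, j) (u, i)"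
    by (auto simp: prec_mod_def dest: prec_add_cancel)
  then show ?thesis
    using assms k by (auto simp: term_less_def val_mult wdot_add)
qed

text \<open>
  All bounds on terms in this proof are of the form that every term of a vector satisfies an upward
  closed predicate. By the ultrametric inequality such bounds pass to sums, differences and constant
  multiples.
\<close>

definition upward_closed :: "(('a, 'n, 'd::linorder) mterm \<Rightarrow> bool) \<Rightarrow> bool" where
  "upward_closed P \<longleftrightarrow> (\<forall>t t'. P t \<longrightarrow> \<not> tless t' t \<longrightarrow> P t')"

lemma upward_closed_above: "upward_closed (\<lambda>t'. tless t t')"
  and upward_closed_not_below: "upward_closed (\<lambda>t'. \<not> tless t' t)"
  using tless_cotrans unfolding upward_closed_def by blast+

text \<open>
  If a term of \<open>h\<close> is given, then \<open>f\<close> or \<open>g\<close> has a term with the same monomial and a valuation that is not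
  larger; it satisfies \<open>P\<close> and is not above the given one.
\<close>

lemma all_terms_ultrametric:
  assumes P: "upward_closed P"
    and "\<forall>t\<in>mterms f. P t" and "\<forall>t\<in>mterms g. P t"
    and le: "\<And>k u. min (val p (coef f k u)) (val p (coef g k u)) \<le> val p (coef h k u)"
  shows "\<forall>t\<in>mterms h. P t"
proof
  fix t assume "t \<in> mterms h"
  obtain x u k where t: "t = (x, u, k)" by (cases t)
  have x: "x = coef h k u" "x \<noteq> 0"
    using \<open>t \<in> mterms h\<close> by (auto simp: t mem_mterms_iff)
  have *: "P t" if "\<forall>t\<in>mterms f'. P t" "val p (coef f' k u) \<le> val p x" for f'
  proof -
    have "coef f' k u \<noteq> 0"
      using that(2) val_finite[OF x(2)] by auto
    then have "P (coef f' k u, u, k)"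
      using that(1) by (simp add: mem_mterms_iff)
    then show ?thesis
      using P that(2) tless_same_monomial_iff[of x u k "coef f' k u"]
      unfolding upward_closed_def t not_less[symmetric] by blast
  qed
  show "P t"
    using le[of k u] *[OF assms(2)] *[OF assms(3)] unfolding x(1) min_le_iff_disj by blast
qed

lemma all_terms_add:
  assumes "upward_closed P" "\<forall>t\<in>mterms f. P t" "\<forall>t\<in>mterms g. P t"
  shows "\<forall>t\<in>mterms (f + g). P t"
  using assms by (rule all_terms_ultrametric) (simp add: lookup_add val_add)

lemma all_terms_diff:
  assumes "upward_closed P" "\<forall>t\<in>mterms f. P t" "\<forall>t\<in>mterms g. P t"
  shows "\<forall>t\<in>mterms (f - g). P t"
  using assms by (rule all_terms_ultrametric) (simp add: lookup_minus val_diff)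

lemma all_terms_const_mult:
  assumes "upward_closed P" "\<forall>t\<in>mterms f. P t"
  shows "\<forall>t\<in>mterms (Poly_Mapping.single 0 c *s f). P t"
  using assms(1,2,2)
proof (rule all_terms_ultrametric)
  fix k u
  have "coef f k u dvd c * coef f k u"
    by simp
  then show "min (val p (coef f k u)) (val p (coef f k u))
      \<le> val p (coef (Poly_Mapping.single 0 c *s f) k u)"
    unfolding coef_const_mult by (simp only: dvd_iff_val_le min.idem)
qed

lemma initial_exists:
  assumes "f \<noteq> 0"
  shows "\<exists>t. initial f = Some t \<and> t \<in> mterms f \<and> (\<forall>t'\<in>mterms f. \<not> tless t' t)"
proof -
  have tot: "tless t t' \<or> tless t' t" if "t \<in> mterms f" "t' \<in> mterms f" "t \<noteq> t'" for t t'
    using that by (intro tless_total) (auto simp: mterms_def)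
  have "\<exists>t\<in>mterms f. \<forall>t'\<in>mterms f. t' \<noteq> t \<longrightarrow> \<not> tless t' t"
    using assms finite_mterms mterms_eq_empty_iff
    by (intro Finite_Set.bex_min_element)
      (auto simp: asymp_on_def transp_on_def intro: tless_trans dest: tless_trans simp: tless_irrefl)
  then obtain t where t: "t \<in> mterms f" "\<forall>t'\<in>mterms f. \<not> tless t' t"
    using tless_irrefl by (metis (full_types))
  have "(THE t. t \<in> mterms f \<and> (\<forall>t'\<in>mterms f - {t}. tless t t')) = t"
  proof (rule the_equality)
    show "t \<in> mterms f \<and> (\<forall>t'\<in>mterms f - {t}. tless t t')"
      using t tot by blast
  next
    fix s assume "s \<in> mterms f \<and> (\<forall>t'\<in>mterms f - {s}. tless s t')"
    then show "s = t"
      using t by blast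
  qed
  then show ?thesis
    using t assms by (simp add: in_term_def)
qed

lemma initial_0 [simp]: "initial 0 = None"
  by (simp add: in_term_def)

lemma initial_SomeD:
  assumes "initial f = Some t"
  shows "f \<noteq> 0" "t \<in> mterms f" "t' \<in> mterms f \<Longrightarrow> \<not> tless t' t"
  using assms initial_exists[of f] by (cases "f = 0"; auto)+

text \<open>
  With the convention that the initial term of \<open>0\<close> is larger than every term, comparisons with an initial
  term are comparisons with all terms, vacuously so for the zero vector.
\<close>

lemma in_less_initial_iff: "in_less p w prec (Some t) (initial f) \<longleftrightarrow> (\<forall>t'\<in>mterms f. tless t t')"
proof (cases "f = 0")
  case True
  then show ?thesis
    using mterms_eq_empty_iff[of f] by simp
next
  case False
  then show ?thesis
    using initial_exists[of f] tless_cotrans by fastforce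
qed

lemma in_ge_initial:
  assumes "\<forall>t\<in>mterms f. in_ge p w prec (Some t) T"
  shows "in_ge p w prec (initial f) T"
proof (cases "f = 0")
  case False
  then show ?thesis
    using assms initial_exists[of f] by auto
qed (simp add: in_ge_def)

lemma upward_closed_in_ge_initial: "upward_closed (\<lambda>t. in_ge p w prec (Some t) (initial f))"
  unfolding upward_closed_def in_ge_def in_less_initial_iff using tless_cotrans by blast

text \<open>
  Terms with different monomials are never equivalent, so once the coefficient at the monomial of \<open>t\<close> has
  cancelled, the remaining terms are strictly larger than \<open>t\<close>.
\<close>

lemma all_terms_above_initial:
  assumes "initial q = Some t"
    and "\<forall>t'\<in>mterms f. \<not> tless t' t"
    and "coef f (snd (snd t)) (fst (snd t)) = coef q (snd (snd t)) (fst (snd t))"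
  shows "\<forall>t'\<in>mterms (q - f). tless t t'"
proof
  fix t' assume t': "t' \<in> mterms (q - f)"
  have "\<forall>t'\<in>mterms (q - f). \<not> tless t' t"
    using initial_SomeD(3)[OF assms(1)] assms(2)
    by (intro all_terms_diff upward_closed_not_below) blast+
  moreover have "snd t' \<noteq> snd t"
    using t' assms(3) by (cases t; cases t') (auto simp: mem_mterms_iff lookup_minus)
  ultimately show "tless t t'"
    using t' tless_total by blast
qed

lemma is_quotientE:
  assumes "initial q = Some t" and "is_quotient (initial q) (initial b) c"
  obtains a \<beta> \<gamma> i b0 c' where "t = (a, \<gamma> + \<beta>, i)" "initial b = Some (b0, \<beta>, i)"
    "c' * b0 = a" "c = Poly_Mapping.single \<gamma> c'"
proof -
  obtain a \<alpha> i b0 \<beta> c' where q: "initial q = Some (a, \<alpha>, i)"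
    and b: "initial b = Some (b0, \<beta>, i)" and dv: "in_dvd (initial b) (initial q)"
    and c': "c' * b0 = a" and c: "c = Poly_Mapping.single (\<alpha> - \<beta>) c'"
    using assms(2) unfolding is_quotient_def by blast
  obtain \<gamma> where "\<alpha> = \<beta> + \<gamma>"
    using dv unfolding q b in_dvd.simps by blast
  then have "\<alpha> = \<gamma> + \<beta>" and "\<alpha> - \<beta> = \<gamma>"
    by (simp_all add: add.commute)
  then show ?thesis
    using that[of a \<gamma> \<beta> i b0 c'] assms(1) q b c' c by simp
qed

text \<open>
  The progress made by one reduction: the multiple \<open>c *s b\<close> has the initial term of \<open>q\<close> as a smallest
  term, and it cancels in \<open>q - c *s b\<close>. Terms of \<open>b\<close> that \<open>c\<close> annihilates simply disappear.
\<close>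

lemma quotient_mult:
  assumes q: "initial q = Some t" and quot: "is_quotient (initial q) (initial b) c"
  shows "\<forall>t'\<in>mterms (c *s b). \<not> tless t' t"
    and "\<forall>t'\<in>mterms (q - c *s b). tless t t'"
proof -
  obtain a \<beta> \<gamma> i b0 c' where t: "t = (a, \<gamma> + \<beta>, i)" and b: "initial b = Some (b0, \<beta>, i)"
    and c': "c' * b0 = a" and c: "c = Poly_Mapping.single \<gamma> c'"
    using assms by (rule is_quotientE)
  have "a \<noteq> 0" and "a = coef q i (\<gamma> + \<beta>)"
    using initial_SomeD(2)[OF q] by (auto simp: t mem_mterms_iff)
  then have a: "coef q i (\<gamma> + \<beta>) = c' * b0"
    using c' by simp
  show *: "\<forall>t'\<in>mterms (c *s b). \<not> tless t' t"
  proof (intro ballI notI)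
    fix t' assume t': "t' \<in> mterms (c *s b)" "tless t' t"
    obtain x u k where x: "t' = (x, u, k)" by (cases t')
    obtain y \<delta> where y: "u = \<gamma> + \<delta>" "x = c' * y" "(y, \<delta>, k) \<in> mterms b"
      using t'(1) unfolding x c by (rule mterms_monomial_mult)
    have "x \<noteq> 0"
      using t'(1) unfolding x mem_mterms_iff by blast
    then have "tless (y, \<delta>, k) (b0, \<beta>, i)"
      using t'(2) \<open>a \<noteq> 0\<close> tless_mult_cancel[of c' y \<gamma> \<delta> k b0 \<beta> i]
      unfolding x t y(1,2) c'[symmetric] by blast
    then show False
      using initial_SomeD(3)[OF b y(3)] by simp
  qed
  have "coef b i \<beta> = b0"
    using initial_SomeD(2)[OF b] by (simp add: mem_mterms_iff)
  then have "coef (c *s b) i (\<gamma> + \<beta>) = coef q i (\<gamma> + \<beta>)"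
    using lookup_single_mult_add[of \<gamma> c' "b $ i" \<beta>] unfolding a c by simp
  then show "\<forall>t'\<in>mterms (q - c *s b). tless t t'"
    by (intro all_terms_above_initial[OF q *]) (simp add: t)
qed

lemma tless_val_cong:
  "val p a = val p b \<Longrightarrow> tless (a, u, k) t \<longleftrightarrow> tless (b, u, k) t"
  by (cases t) (simp add: term_less_def)

lemma in_dvd_val_cong:
  fixes a b :: "'a mod_ring"
  assumes "val p a = val p b"
  shows "in_dvd T (Some (a, u, k)) \<longleftrightarrow> in_dvd T (Some (b, u, k))"
proof (cases T)
  case (Some t)
  then show ?thesis
    using assms by (cases t) (simp add: dvd_iff_val_le)
qed simp

end

section \<open>Homogeneous vectors\<close>

text \<open>
  The degree is a parameter because a difference of homogeneous vectors is in general homogeneous only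
  if the degrees agree.
\<close>

definition homogeneous_of :: "nat \<Rightarrow> ('a::nontriv, 'n::finite, 'd::finite) mvec \<Rightarrow> bool" where
  "homogeneous_of m f \<longleftrightarrow> (\<forall>k u. coef f k u \<noteq> 0 \<longrightarrow> expo_deg u = m)"

lemma homogeneous_iff: "homogeneous f \<longleftrightarrow> (\<exists>m. homogeneous_of m f)"
proof -
  have "(\<forall>(c, u, k)\<in>mterms f. expo_deg u = m) \<longleftrightarrow> homogeneous_of m f" for m
    by (auto simp: homogeneous_of_def mterms_def)
  then show ?thesis
    unfolding homogeneous_def by simp
qed

lemma homogeneous_of_diff:
  assumes "homogeneous_of m f" "homogeneous_of m g"
  shows "homogeneous_of m (f - g)"
  unfolding homogeneous_of_def
proof (intro allI impI)
  fix k u assume "coef (f - g) k u \<noteq> 0"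
  then have "coef f k u \<noteq> 0 \<or> coef g k u \<noteq> 0"
    by (auto simp: lookup_minus)
  then show "expo_deg u = m"
    using assms unfolding homogeneous_of_def by blast
qed

lemma homogeneous_of_const_mult:
  assumes "homogeneous_of m f"
  shows "homogeneous_of m (Poly_Mapping.single 0 c *s f)"
  unfolding homogeneous_of_def coef_const_mult
proof (intro allI impI)
  fix k u assume "c * coef f k u \<noteq> 0"
  then have "coef f k u \<noteq> 0"
    by auto
  then show "expo_deg u = m"
    using assms unfolding homogeneous_of_def by blast
qed

lemma expo_deg_add: "expo_deg (u + v) = expo_deg u + expo_deg v"
  by (simp add: expo_deg_def lookup_add sum.distrib)

lemma expo_deg_eq_0_iff: "expo_deg u = 0 \<longleftrightarrow> u = 0"
  by (auto simp: expo_deg_def intro: poly_mapping_eqI)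

lemma finite_expo_deg: "finite {u :: 'n::finite expo. expo_deg u = m}"
proof (rule finite_imageD)
  have "Poly_Mapping.lookup ` {u :: 'n expo. expo_deg u = m} \<subseteq> UNIV \<rightarrow>\<^sub>E {..m}"
  proof clarify
    fix u :: "'n expo"
    have "Poly_Mapping.lookup u i \<le> expo_deg u" for i
      unfolding expo_deg_def by (intro member_le_sum) auto
    then show "Poly_Mapping.lookup u \<in> UNIV \<rightarrow>\<^sub>E {..expo_deg u}"
      by auto
  qed
  then show "finite (Poly_Mapping.lookup ` {u :: 'n expo. expo_deg u = m})"
    by (rule finite_subset) (intro finite_PiE; simp)
  show "inj_on Poly_Mapping.lookup {u :: 'n expo. expo_deg u = m}"
    by (intro inj_onI) (simp only: poly_mapping.lookup_inject)
qed

lemma vector_smult_sum_right: "(a :: 'b::comm_ring_1) *s (\<Sum>i\<in>I. F i) = (\<Sum>i\<in>I. a *s (F i :: 'b ^ 'd))"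
  by (simp add: vec_eq_iff sum_distrib_left)

section \<open>The invariants of the division algorithm\<close>

locale module_division = weighted_monomial_order p l ring_type w prec
  for p l :: nat and ring_type :: "'a::nontriv itself"
    and w :: "real ^ 'n::finite" and prec :: "'n expo \<Rightarrow> 'n expo \<Rightarrow> bool" +
  fixes s m :: nat
    and f :: "('a, 'n, 'd::{finite,linorder}) mvec"
    and g :: "nat \<Rightarrow> ('a, 'n, 'd) mvec"
  assumes homogeneous_f: "homogeneous_of m f"
    and homogeneous_g: "\<And>i. i \<in> {1..s} \<Longrightarrow> homogeneous (g i)"
begin

abbreviation geq_initial :: "('a, 'n, 'd) mvec \<Rightarrow> bool" where
  "geq_initial v \<equiv> \<forall>t\<in>mterms v. in_ge p w prec (Some t) (initial f)"

abbreviation combination :: "(nat \<Rightarrow> ('a, 'n) mpoly) \<Rightarrow> ('a, 'n, 'd) mvec" where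
  "combination h \<equiv> (\<Sum>i=1..s. h i *s g i)"

text \<open>
  What holds for the current triple and for every stored one alike.
\<close>

definition partial_division ::
  "('a, 'n, 'd) mvec \<Rightarrow> (nat \<Rightarrow> ('a, 'n) mpoly) \<Rightarrow> ('a, 'n, 'd) mvec \<Rightarrow> bool" where
  "partial_division q h r \<longleftrightarrow> homogeneous_of m q \<and> f = q + combination h + r \<and>
     geq_initial q \<and> geq_initial r \<and> (\<forall>i\<in>{1..s}. geq_initial (h i *s g i))"

lemma partial_division_eq: "partial_division q h r \<Longrightarrow> f = q + combination h + r"
  unfolding partial_division_def by (elim conjE)

lemma partial_divisionD:
  assumes "partial_division q h r"
  shows "homogeneous_of m q" "geq_initial q" "geq_initial r" "\<forall>i\<in>{1..s}. geq_initial (h i *s g i)"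
  using assms unfolding partial_division_def by - (elim conjE, assumption)+

lemma partial_division_init: "partial_division f (\<lambda>_. 0) 0"
proof -
  have "geq_initial f"
    unfolding in_ge_def in_less_initial_iff using tless_irrefl by blast
  moreover have "0 *s v = 0" for v :: "('a, 'n, 'd) mvec"
    by (simp add: vec_eq_iff)
  moreover have "mterms (0 :: ('a, 'n, 'd) mvec) = {}"
    by (simp add: mterms_eq_empty_iff)
  ultimately show ?thesis
    using homogeneous_f by (simp add: partial_division_def)
qed

lemma geq_initial_diff: "geq_initial v \<Longrightarrow> geq_initial v' \<Longrightarrow> geq_initial (v - v')"
  by (intro all_terms_diff upward_closed_in_ge_initial)

lemma geq_initial_add: "geq_initial v \<Longrightarrow> geq_initial v' \<Longrightarrow> geq_initial (v + v')"
  by (intro all_terms_add upward_closed_in_ge_initial)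

lemma geq_initial_const_mult: "geq_initial v \<Longrightarrow> geq_initial (Poly_Mapping.single 0 c *s v)"
  by (intro all_terms_const_mult upward_closed_in_ge_initial)

text \<open>
  The equations for \<open>(q, h, r)\<close> and \<open>(q', h', r')\<close> combine to one for \<open>v (f - c f)\<close>, which is \<open>f\<close>.
\<close>

lemma partial_division_combine:
  assumes "partial_division q h r" and "partial_division q' h' r'"
    and inv: "v0 * (1 - c0) = 1"
    and c: "c = Poly_Mapping.single 0 c0" and v: "v = Poly_Mapping.single 0 v0"
  shows "partial_division (v *s (q - c *s q')) (\<lambda>i. v * (h i - c * h' i)) (v *s (r - c *s r'))"
proof -
  note pd = partial_divisionD[OF assms(1)] partial_divisionD[OF assms(2)]
  have vc: "v * (1 - c) = 1"
    unfolding c v by (simp add: mult_single inv flip: single_one single_diff)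
  have hg: "(v * (h i - c * h' i)) *s g i = v *s (h i *s g i - c *s (h' i *s g i))" for i
    by (simp add: vector_ssub_ldistrib vector_sub_rdistrib vector_smult_assoc right_diff_distrib)
  have "f = (v * (1 - c)) *s f"
    unfolding vc by (simp add: vec_eq_iff)
  also have "\<dots> = v *s (f - c *s f)"
    by (simp add: vector_ssub_ldistrib vector_sub_rdistrib vector_smult_assoc right_diff_distrib)
  also have "\<dots> = v *s ((q + combination h + r) - c *s (q' + combination h' + r'))"
    using partial_division_eq[OF assms(1)] partial_division_eq[OF assms(2)] by (rule arg_cong2)
  also have "\<dots> = v *s (q - c *s q') + v *s (combination h - c *s combination h') + v *s (r - c *s r')"
    by (simp add: vector_ssub_ldistrib vector_add_ldistrib)
  also have "v *s (combination h - c *s combination h')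
      = (\<Sum>i=1..s. (v * (h i - c * h' i)) *s g i)"
    unfolding hg by (simp add: vector_smult_sum_right vector_ssub_ldistrib sum_subtractf)
  finally have "f = v *s (q - c *s q') + (\<Sum>i=1..s. (v * (h i - c * h' i)) *s g i) + v *s (r - c *s r')" .
  moreover have "homogeneous_of m (v *s (q - c *s q'))"
    using pd unfolding c v by (intro homogeneous_of_const_mult homogeneous_of_diff)
  moreover have bd: "geq_initial (v *s (x - c *s y))" if "geq_initial x" "geq_initial y" for x y
    using that unfolding c v by (intro geq_initial_const_mult geq_initial_diff)
  moreover have "\<forall>i\<in>{1..s}. geq_initial ((v * (h i - c * h' i)) *s g i)"
    unfolding hg using pd(4,8) by (intro ballI bd) blast+
  ultimately show ?thesis
    unfolding partial_division_def by (intro conjI bd pd)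
qed

text \<open>
  Apart from \<open>partial_division\<close>, the invariant records how the triples are related. The initial terms of stored
  vectors and the terms of the remainder are smaller than everything left in \<open>q\<close>; and the remainder
  agrees up to valuation with each stored remainder \<open>r'\<close> wherever \<open>r'\<close> is nonzero.
\<close>

definition division_invariant :: "('a, 'n, 'd) div_state \<Rightarrow> bool" where
  "division_invariant \<sigma> \<longleftrightarrow>
     partial_division (qpart \<sigma>) (hpart \<sigma>) (rpart \<sigma>) \<and>
     (\<forall>(q', h', r')\<in>stored \<sigma>. partial_division q' h' r' \<and>
        (\<exists>t. initial q' = Some t \<and> (\<forall>t'\<in>mterms (qpart \<sigma>). tless t t')) \<and>
        (\<forall>k u. coef r' k u \<noteq> 0 \<longrightarrow> val p (coef (rpart \<sigma>) k u) = val p (coef r' k u))) \<and>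
     (\<forall>t\<in>mterms (rpart \<sigma>). \<forall>t'\<in>mterms (qpart \<sigma>). tless t t') \<and>
     (\<forall>i\<in>{1..s}. \<forall>t\<in>mterms (rpart \<sigma>). \<not> in_dvd (initial (g i)) (Some t))"

lemma division_invariant_init: "division_invariant (div_init f)"
proof -
  have "mterms (0 :: ('a, 'n, 'd) mvec) = {}"
    by (simp add: mterms_eq_empty_iff)
  then show ?thesis
    using partial_division_init by (simp add: division_invariant_def div_init_def)
qed

text \<open>
  The part of the preservation proof common to all steps. In steps (2a) and (2b) the valuations of the
  coefficients of the remainder do not change at all; in step (1) the only possible change is that the
  initial term \<open>T\<close> appears where the coefficient was zero, and \<open>T\<close> has been found indivisible.
\<close>

lemma division_invariant_step:
  assumes inv: "division_invariant \<sigma>" and T: "initial (qpart \<sigma>) = Some T"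
    and pd: "partial_division q h r" and above: "\<forall>t\<in>mterms q. tless T t"
    and st: "st \<subseteq> put_current \<sigma>"
    and rem: "\<And>k u. val p (coef r k u) = val p (coef (rpart \<sigma>) k u) \<or>
      coef (rpart \<sigma>) k u = 0 \<and> (coef r k u, u, k) = T \<and>
      (\<forall>i\<in>{1..s}. \<not> in_dvd (initial (g i)) (Some T))"
  shows "division_invariant \<lparr>qpart = q, hpart = h, rpart = r, stored = st\<rparr>"
proof -
  note I = inv[unfolded division_invariant_def]
  have TQ: "T \<in> mterms (qpart \<sigma>)"
    using T by (rule initial_SomeD)
  have mono: "val p (coef r k u) = val p (coef (rpart \<sigma>) k u)" if "coef (rpart \<sigma>) k u \<noteq> 0" for k u
    using rem[of k u] that by blast
  have S: "partial_division q' h' r' \<and> (\<exists>t. initial q' = Some t \<and> (\<forall>t'\<in>mterms q. tless t t')) \<and>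
      (\<forall>k u. coef r' k u \<noteq> 0 \<longrightarrow> val p (coef r k u) = val p (coef r' k u))"
    if "(q', h', r') \<in> st" for q' h' r'
  proof (cases "(q', h', r') = (qpart \<sigma>, hpart \<sigma>, rpart \<sigma>)")
    case True
    then show ?thesis
      using I T above mono by simp
  next
    case False
    then have "(q', h', r') \<in> stored \<sigma>"
      using that st by (auto simp: put_current_def)
    then have *: "partial_division q' h' r'"
        "\<exists>t. initial q' = Some t \<and> (\<forall>t'\<in>mterms (qpart \<sigma>). tless t t')"
        "\<And>k u. coef r' k u \<noteq> 0 \<Longrightarrow> val p (coef (rpart \<sigma>) k u) = val p (coef r' k u)"
      using I by blast+
    have "val p (coef r k u) = val p (coef r' k u)" if nz: "coef r' k u \<noteq> 0" for k u
    proof -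
      have "coef (rpart \<sigma>) k u \<noteq> 0"
        using *(3)[OF nz] val_finite[OF nz] by auto
      then show ?thesis
        using mono *(3)[OF nz] by simp
    qed
    moreover have "\<exists>t. initial q' = Some t \<and> (\<forall>t'\<in>mterms q. tless t t')"
      using *(2) TQ above tless_trans by blast
    ultimately show ?thesis
      using *(1) by blast
  qed
  have R: "(\<forall>t'\<in>mterms q. tless t t') \<and> (\<forall>i\<in>{1..s}. \<not> in_dvd (initial (g i)) (Some t))"
    if "t \<in> mterms r" for t
  proof -
    obtain x u k where t: "t = (x, u, k)" by (cases t)
    have x: "x = coef r k u" "x \<noteq> 0"
      using that by (auto simp: t mem_mterms_iff)
    show ?thesis
    proof (cases "t = T \<and> (\<forall>i\<in>{1..s}. \<not> in_dvd (initial (g i)) (Some T))")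
      case True
      then show ?thesis
        using above by blast
    next
      case False
      then have v: "val p x = val p (coef (rpart \<sigma>) k u)"
        using rem[of k u] t x(1) by blast
      then have "coef (rpart \<sigma>) k u \<noteq> 0"
        using val_finite[OF x(2)] by auto
      then have old: "(coef (rpart \<sigma>) k u, u, k) \<in> mterms (rpart \<sigma>)"
        by (simp add: mem_mterms_iff)
      then have "tless t T"
        using I TQ unfolding t tless_val_cong[OF v] by blast
      then have "\<forall>t'\<in>mterms q. tless t t'"
        using above tless_trans by blast
      moreover have "\<forall>i\<in>{1..s}. \<not> in_dvd (initial (g i)) (Some t)"
        using I old unfolding t in_dvd_val_cong[OF v] by blast
      ultimately show ?thesis ..
    qed
  qed
  show ?thesis
    unfolding division_invariant_def using pd S R by auto
qed

text \<open>
  The degrees of the monomial of \<open>c\<close> and of the initial term of \<open>b\<close> add up to the degree \<open>m\<close> of the initial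
  term of \<open>q\<close>, and all terms of \<open>b\<close> have the degree of its initial term.
\<close>

lemma homogeneous_quotient_mult:
  assumes q: "initial q = Some t" "homogeneous_of m q"
    and b: "homogeneous b" and quot: "is_quotient (initial q) (initial b) c"
  shows "homogeneous_of m (c *s b)"
proof -
  obtain a \<beta> \<gamma> i b0 c' where t: "t = (a, \<gamma> + \<beta>, i)" and b': "initial b = Some (b0, \<beta>, i)"
    and c: "c = Poly_Mapping.single \<gamma> c'"
    using q(1) quot by (rule is_quotientE)
  obtain n where n: "homogeneous_of n b"
    using b homogeneous_iff by blast
  have "expo_deg (\<gamma> + \<beta>) = m"
    using q(2) initial_SomeD(2)[OF q(1)] unfolding homogeneous_of_def t mem_mterms_iff by blast
  moreover have "expo_deg \<beta> = n"
    using n initial_SomeD(2)[OF b'] unfolding homogeneous_of_def mem_mterms_iff by blast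
  ultimately have "expo_deg \<gamma> + n = m"
    by (simp add: expo_deg_add)
  show ?thesis
    unfolding homogeneous_of_def
  proof (intro allI impI)
    fix k u assume nz: "coef (c *s b) k u \<noteq> 0"
    then have "(coef (c *s b) k u, u, k) \<in> mterms (Poly_Mapping.single \<gamma> c' *s b)"
      unfolding c mem_mterms_iff by blast
    then obtain y \<delta> where "u = \<gamma> + \<delta>" "(y, \<delta>, k) \<in> mterms b"
      by (rule mterms_monomial_mult)
    then show "expo_deg u = m"
      using n \<open>expo_deg \<gamma> + n = m\<close> unfolding homogeneous_of_def mem_mterms_iff
      by (auto simp: expo_deg_add)
  qed
qed

text \<open>
  Both initial terms have degree \<open>m\<close>, so the exponent \<open>\<gamma>\<close> of the quotient has degree \<open>0\<close>. The initial term of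
  \<open>q'\<close> is the smaller one, and as the monomials agree, this means that its coefficient has the smaller
  valuation.
\<close>

lemma stored_quotient_const:
  assumes inv: "division_invariant \<sigma>" and q: "initial (qpart \<sigma>) = Some T"
    and st: "(q', h', r') \<in> stored \<sigma>"
    and quot: "is_quotient (initial (qpart \<sigma>)) (initial q') c"
  obtains c0 where "c = Poly_Mapping.single 0 c0" "0 < val p c0"
proof -
  obtain a \<beta> \<gamma> i b0 c' where t: "T = (a, \<gamma> + \<beta>, i)" and b: "initial q' = Some (b0, \<beta>, i)"
    and c': "c' * b0 = a" and c: "c = Poly_Mapping.single \<gamma> c'"
    using q quot by (rule is_quotientE)
  have "partial_division (qpart \<sigma>) (hpart \<sigma>) (rpart \<sigma>)" "partial_division q' h' r'"
    using inv st unfolding division_invariant_def by blast+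
  then have "homogeneous_of m (qpart \<sigma>)" "homogeneous_of m q'"
    using partial_divisionD(1) by blast+
  then have "expo_deg (\<gamma> + \<beta>) = m" "expo_deg \<beta> = m"
    using initial_SomeD(2)[OF q] initial_SomeD(2)[OF b]
    unfolding homogeneous_of_def t mem_mterms_iff by blast+
  then have \<gamma>: "\<gamma> = 0"
    by (simp add: expo_deg_add expo_deg_eq_0_iff)
  have "\<exists>t. initial q' = Some t \<and> (\<forall>t'\<in>mterms (qpart \<sigma>). tless t t')"
    using inv st unfolding division_invariant_def by blast
  then have "tless (b0, \<beta>, i) T"
    using b initial_SomeD(2)[OF q] by simp
  then have less: "val p b0 < val p a"
    unfolding t \<gamma> by (simp add: tless_same_monomial_iff)
  have "a \<noteq> 0"
    using initial_SomeD(2)[OF q] unfolding t mem_mterms_iff by blast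
  then have "val p a = val p c' + val p b0"
    using val_mult[of c' b0] c' by simp
  then have "0 < val p c'"
    using less val_nonneg[of c'] by (cases "val p c' = 0") auto
  then show ?thesis
    using that[of c'] c \<gamma> by simp
qed

lemma mterms_in_vec:
  "c \<noteq> 0 \<Longrightarrow> mterms (in_vec (Some (c, u, k)) :: ('a, 'n, 'd) mvec) = {(c, u, k)}"
  by (auto simp: mterms_def coef_in_vec simp del: in_vec.simps split: if_splits)

lemma div_step_invariant:
  assumes step: "div_step p w prec s g (Some \<sigma>) Y" and inv: "division_invariant \<sigma>"
  shows "\<exists>\<sigma>' T. Y = Some \<sigma>' \<and> division_invariant \<sigma>' \<and>
    initial (qpart \<sigma>) = Some T \<and> (\<forall>t\<in>mterms (qpart \<sigma>'). tless T t)"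
proof -
  have "qpart \<sigma> \<noteq> 0"
    using step by cases auto
  then obtain T where T: "initial (qpart \<sigma>) = Some T"
    using initial_exists by blast
  note I = inv[unfolded division_invariant_def]
  note pd = conjunct1[OF I]
  note pd' = partial_divisionD[OF pd]
  have st: "stored \<sigma> \<subseteq> put_current \<sigma>" "stored_after \<sigma> b \<subseteq> put_current \<sigma>" for b
    by (auto simp: put_current_def stored_after_def)
  have TQ: "T \<in> mterms (qpart \<sigma>)"
    using T by (rule initial_SomeD)
  have T_geq: "in_ge p w prec (Some T) (initial f)"
    using pd' TQ by blast
  show ?thesis
    using step
  proof cases
    case step_1
    obtain a \<alpha> i where t: "T = (a, \<alpha>, i)" by (cases T)
    define x where "x = (in_vec (Some T) :: ('a, 'n, 'd) mvec)"
    have "a \<noteq> 0" and a: "coef (qpart \<sigma>) i \<alpha> = a"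
      using TQ by (auto simp: t mem_mterms_iff)
    then have mx: "mterms x = {T}"
      unfolding x_def t by (intro mterms_in_vec)
    have cx: "coef x k u = (if k = i \<and> u = \<alpha> then a else 0)" for k u
      unfolding x_def t by (rule coef_in_vec)
    have above: "\<forall>t\<in>mterms (qpart \<sigma> - x). tless T t"
      using T by (rule all_terms_above_initial) (simp_all add: mx tless_irrefl t cx a)
    have "homogeneous_of m x"
      using pd' a \<open>a \<noteq> 0\<close> by (auto simp: homogeneous_of_def cx)
    moreover have "geq_initial x"
      using T_geq mx by simp
    moreover have eq: "f = (qpart \<sigma> - x) + combination (hpart \<sigma>) + (rpart \<sigma> + x)"
      by (subst partial_division_eq[OF pd]) (simp only: algebra_simps)
    ultimately have pd_new: "partial_division (qpart \<sigma> - x) (hpart \<sigma>) (rpart \<sigma> + x)"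
      using pd' eq unfolding partial_division_def
      by (intro conjI homogeneous_of_diff geq_initial_diff geq_initial_add)
    have "\<forall>i\<in>{1..s}. \<not> in_dvd (initial (g i)) (Some T)"
      using step_1 T unfolding candidate_def divisor_set_def by auto
    moreover have "val p (coef (rpart \<sigma> + x) k u) = val p (coef (rpart \<sigma>) k u) \<or>
      coef (rpart \<sigma>) k u = 0 \<and> (coef (rpart \<sigma> + x) k u, u, k) = T" for k u
    \<comment> \<open>An older term of the remainder with the monomial of \<open>T\<close> is below \<open>T\<close>, so its valuation survives.\<close>
    proof (cases "k = i \<and> u = \<alpha> \<and> coef (rpart \<sigma>) k u \<noteq> 0")
      case True
      then have "(coef (rpart \<sigma>) k u, u, k) \<in> mterms (rpart \<sigma>)"
        unfolding mem_mterms_iff by blast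
      then have "tless (coef (rpart \<sigma>) k u, u, k) T"
        using I TQ by blast
      then have "val p (coef (rpart \<sigma>) k u) < val p a"
        using True by (simp add: t tless_same_monomial_iff)
      then show ?thesis
        using True by (simp add: lookup_add cx val_add_eq)
    next
      case False
      then show ?thesis
        by (auto simp: lookup_add cx t)
    qed
    ultimately have "division_invariant \<lparr>qpart = qpart \<sigma> - x, hpart = hpart \<sigma>,
        rpart = rpart \<sigma> + x, stored = put_current \<sigma>\<rparr>"
      using above by (intro division_invariant_step[OF inv T pd_new]) blast+
    then show ?thesis
      using step_1(1) T above by (simp add: x_def del: in_vec.simps)
  next
    case (step_2a k c)
    have quot: "is_quotient (initial (qpart \<sigma>)) (initial (g k)) c"
      using step_2a unfolding choice_def by blast
    note mult = quotient_mult[OF T quot]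
    have "homogeneous_of m (c *s g k)"
      using T pd'(1) homogeneous_g[OF step_2a(3)] quot by (rule homogeneous_quotient_mult)
    moreover have bd: "geq_initial (c *s g k)"
      using mult(1) T_geq upward_closed_in_ge_initial[of f] unfolding upward_closed_def by blast
    moreover have "\<forall>i\<in>{1..s}. geq_initial (((hpart \<sigma>)(k := hpart \<sigma> k + c)) i *s g i)"
    proof
      fix i assume that: "i \<in> {1..s}"
      show "geq_initial (((hpart \<sigma>)(k := hpart \<sigma> k + c)) i *s g i)"
      proof (cases "i = k")
        case True
        have "geq_initial (hpart \<sigma> k *s g k + c *s g k)"
          using pd'(4) step_2a(3) bd by (intro geq_initial_add) blast+
        then show ?thesis
          using True by (simp only: fun_upd_same vector_sadd_rdistrib)
      next
        case False
        show ?thesis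
          unfolding fun_upd_other[OF False] using pd'(4) that by (rule bspec)
      qed
    qed
    moreover have "f = (qpart \<sigma> - c *s g k) + combination ((hpart \<sigma>)(k := hpart \<sigma> k + c)) + rpart \<sigma>"
    proof -
      have "((hpart \<sigma>)(k := hpart \<sigma> k + c)) i *s g i
          = hpart \<sigma> i *s g i + (if i = k then c *s g k else 0)" for i
        by (simp add: vector_sadd_rdistrib)
      then have "combination ((hpart \<sigma>)(k := hpart \<sigma> k + c)) = combination (hpart \<sigma>) + c *s g k"
        using step_2a(3) by (simp add: sum.distrib)
      then show ?thesis
        by (subst partial_division_eq[OF pd]) simp
    qed
    ultimately have pd_new: "partial_division (qpart \<sigma> - c *s g k) ((hpart \<sigma>)(k := hpart \<sigma> k + c)) (rpart \<sigma>)"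
      using pd' unfolding partial_division_def
      by (intro conjI homogeneous_of_diff geq_initial_diff)
    have "division_invariant \<lparr>qpart = qpart \<sigma> - c *s g k, hpart = (hpart \<sigma>)(k := hpart \<sigma> k + c),
        rpart = rpart \<sigma>, stored = stored_after \<sigma> (g k)\<rparr>"
      using mult(2) st(2) by (intro division_invariant_step[OF inv T pd_new]) blast+
    then show ?thesis
      using step_2a(1) T mult(2) by simp
  next
    case (step_2b q' h' r' c v)
    have quot: "is_quotient (initial (qpart \<sigma>)) (initial q') c"
      using step_2b unfolding choice_def by blast
    note mult = quotient_mult[OF T quot]
    obtain c0 where c0: "c = Poly_Mapping.single 0 c0" "0 < val p c0"
      using inv T step_2b(4) quot by (rule stored_quotient_const)
    obtain c1 v0 where "c = Poly_Mapping.single 0 c1" and v: "v = Poly_Mapping.single 0 v0"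
      and v0: "v0 * (1 - c1) = 1"
      using step_2b(6) unfolding inverse_one_minus_def by blast
    then have v0: "v0 * (1 - c0) = 1"
      using c0(1) by (metis lookup_single_eq)
    have stq: "partial_division q' h' r'"
        "\<And>k u. coef r' k u \<noteq> 0 \<Longrightarrow> val p (coef (rpart \<sigma>) k u) = val p (coef r' k u)"
      using I step_2b(4) by blast+
    note pd_new = partial_division_combine[OF pd stq(1) v0 c0(1) v]
    have above: "\<forall>t\<in>mterms (v *s (qpart \<sigma> - c *s q')). tless T t"
      unfolding v using mult(2) by (intro all_terms_const_mult upward_closed_above)
    have "val p (coef (v *s (rpart \<sigma> - c *s r')) k u) = val p (coef (rpart \<sigma>) k u)" for k u
    proof -
      have "coef (rpart \<sigma> - c *s r') k u = coef (rpart \<sigma>) k u - c0 * coef r' k u"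
        using coef_const_mult[of c0 r' k u] by (simp add: lookup_minus c0(1))
      moreover have "val p (coef (rpart \<sigma>) k u - c0 * coef r' k u) = val p (coef (rpart \<sigma>) k u)"
      \<comment> \<open>The correction has a larger valuation than the coefficient that it is subtracted from.\<close>
      proof (cases "c0 * coef r' k u = 0")
        case False
        then have nz: "coef r' k u \<noteq> 0" by auto
        have "val p (coef r' k u) < val p (c0 * coef r' k u)"
          using val_mult[OF False] c0(2) val_finite[OF nz] val_nonneg[of "coef r' k u"]
          by (cases "val p c0"; cases "val p (coef r' k u)") auto
        then show ?thesis
          using stq(2)[OF nz] by (simp add: val_diff_eq)
      qed simp
      ultimately show ?thesis
        unfolding v coef_const_mult val_mult_left_unit[OF v0] by simp
    qed
    then have "division_invariant \<lparr>qpart = v *s (qpart \<sigma> - c *s q'),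
        hpart = (\<lambda>k. v * (hpart \<sigma> k - c * h' k)), rpart = v *s (rpart \<sigma> - c *s r'),
        stored = stored_after \<sigma> q'\<rparr>"
      using above st(2) by (intro division_invariant_step[OF inv T pd_new]) blast+
    then show ?thesis
      using step_2b(1) T above by simp
  next
    case (step_2b_undefined b c)
    have quot: "is_quotient (initial (qpart \<sigma>)) (initial b) c"
      using step_2b_undefined unfolding choice_def by blast
    obtain h' r' where "(b, h', r') \<in> stored \<sigma>"
      using step_2b_undefined unfolding choice_def candidate_def divisor_set_def by auto
    \<comment> \<open>The inverse exists after all, so this case cannot occur.\<close>
    then obtain c0 where c0: "c = Poly_Mapping.single 0 c0" "0 < val p c0"
      using quot by (rule stored_quotient_const[OF inv T])
    then obtain v0 where "v0 * (1 - c0) = 1"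
      using one_minus_unit by blast
    then have "inverse_one_minus c (Poly_Mapping.single 0 v0)"
      using c0(1) unfolding inverse_one_minus_def by blast
    then show ?thesis
      using step_2b_undefined by blast
  qed
qed

text \<open>
  Some divisor has minimal ecart, since ecarts are natural numbers. If it is not among the \<open>g\<^sub>i\<close>, then it
  is stored along with its \<open>h\<close> and \<open>r\<close>; whether \<open>1 - c\<close> is invertible merely decides which rule applies.
\<close>

lemma div_step_exists:
  assumes inv: "division_invariant \<sigma>" and nz: "qpart \<sigma> \<noteq> 0"
  shows "\<exists>Y. div_step p w prec s g (Some \<sigma>) Y"
proof (cases "\<exists>b. candidate p w prec s g \<sigma> b")
  case False
  then show ?thesis
    using nz step_1 by blast
next
  case True
  then obtain b where b: "candidate p w prec s g \<sigma> b"
    "\<And>b'. candidate p w prec s g \<sigma> b' \<Longrightarrow> ecart b (qpart \<sigma>) \<le> ecart b' (qpart \<sigma>)"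
    using ex_has_least_nat[of "candidate p w prec s g \<sigma>" _ "\<lambda>b. ecart b (qpart \<sigma>)"] by blast
  have dv: "in_dvd (initial b) (initial (qpart \<sigma>))"
    using b(1) unfolding candidate_def by blast
  then obtain a \<alpha> i b0 \<beta> j where ini: "initial (qpart \<sigma>) = Some (a, \<alpha>, i)" "initial b = Some (b0, \<beta>, j)"
    by (cases "initial b"; cases "initial (qpart \<sigma>)") auto
  then have "j = i" "b0 dvd a"
    using dv by auto
  then obtain c' where "c' * b0 = a"
    by (metis dvdE mult.commute)
  then have "is_quotient (initial (qpart \<sigma>)) (initial b) (Poly_Mapping.single (\<alpha> - \<beta>) c')"
    using ini dv \<open>j = i\<close> unfolding is_quotient_def by blast
  then have ch: "choice p w prec s g \<sigma> b (Poly_Mapping.single (\<alpha> - \<beta>) c')"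
    using b unfolding choice_def by blast
  consider k where "k \<in> {1..s}" "b = g k"
    | h' r' where "b \<notin> g ` {1..s}" "(b, h', r') \<in> stored \<sigma>"
    using b(1) unfolding candidate_def divisor_set_def by fastforce
  then show ?thesis
  proof cases
    case 1
    then show ?thesis
      using nz ch step_2a by blast
  next
    case 2
    then show ?thesis
      using step_2b[OF nz 2 ch] step_2b_undefined[OF nz 2(1) ch] by blast
  qed
qed

lemma reachable_invariant:
  assumes "(div_step p w prec s g)\<^sup>*\<^sup>* (Some (div_init f)) X"
  shows "\<exists>\<sigma>. X = Some \<sigma> \<and> division_invariant \<sigma>"
  using assms
proof induction
  case base
  then show ?case
    using division_invariant_init by blast
next
  case (step X Y)
  then show ?case
    using div_step_invariant by blast
qed

text \<open>
  The initial terms along an infinite run would be strictly increasing, hence pairwise distinct, but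
  there are only finitely many terms of degree \<open>m\<close>.
\<close>

lemma no_infinite_run:
  "\<nexists>run. run 0 = Some (div_init f) \<and> (\<forall>i. div_step p w prec s g (run i) (run (Suc i)))"
proof
  assume "\<exists>run. run 0 = Some (div_init f) \<and> (\<forall>i. div_step p w prec s g (run i) (run (Suc i)))"
  then obtain run where run: "run 0 = Some (div_init f)"
    "\<And>i. div_step p w prec s g (run i) (run (Suc i))"
    by blast
  have "(div_step p w prec s g)\<^sup>*\<^sup>* (Some (div_init f)) (run i)" for i
    by (induction i) (use run in \<open>auto intro: rtranclp.rtrancl_into_rtrancl\<close>)
  then have "\<forall>i. \<exists>\<sigma>. run i = Some \<sigma> \<and> division_invariant \<sigma>"
    using reachable_invariant by blast
  then obtain \<sigma> where \<sigma>: "\<And>i. run i = Some (\<sigma> i)" "\<And>i. division_invariant (\<sigma> i)"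
    by metis
  have "\<exists>T. initial (qpart (\<sigma> i)) = Some T \<and> (\<forall>t\<in>mterms (qpart (\<sigma> (Suc i))). tless T t)" for i
    using div_step_invariant[of "\<sigma> i" "run (Suc i)"] run(2)[of i] \<sigma> by auto
  then obtain T where T: "\<And>i. initial (qpart (\<sigma> i)) = Some (T i)"
    "\<And>i. \<forall>t\<in>mterms (qpart (\<sigma> (Suc i))). tless (T i) t"
    by metis
  have mem: "T i \<in> mterms (qpart (\<sigma> i))" for i
    using T(1) by (rule initial_SomeD)
  have step: "tless (T i) (T (Suc i))" for i
    using T(2) mem by blast
  have less: "tless (T i) (T j)" if "i < j" for i j
    using that by (induction rule: less_Suc_induct) (use step tless_trans in blast)+
  then have "inj T"
    by (intro linorder_injI) (metis tless_irrefl)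
  moreover have "range T \<subseteq> UNIV \<times> {u. expo_deg u = m} \<times> UNIV"
  proof (rule image_subsetI)
    fix i
    obtain x u k where t: "T i = (x, u, k)" by (cases "T i")
    have "coef (qpart (\<sigma> i)) k u \<noteq> 0"
      using mem[of i] unfolding t mem_mterms_iff by blast
    moreover have "homogeneous_of m (qpart (\<sigma> i))"
      using \<sigma>(2)[of i] partial_divisionD(1) unfolding division_invariant_def by blast
    ultimately show "T i \<in> UNIV \<times> {u. expo_deg u = m} \<times> UNIV"
      unfolding homogeneous_of_def t by blast
  qed
  then have "finite (range T)"
    by (rule finite_subset) (intro finite_cartesian_product finite_expo_deg finite)
  ultimately show False
    using finite_imageD infinite_UNIV_nat by blast
qed

end

theorem theorem6p7:
  fixes p l s :: nat
    and w :: "real ^ 'n::finite"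
    and prec :: "'n expo \<Rightarrow> 'n expo \<Rightarrow> bool"
    and f :: "('a::nontriv, 'n, 'd::{finite,linorder}) mvec"
    and g :: "nat \<Rightarrow> ('a, 'n, 'd) mvec"
  assumes "prime p" and "0 < l" and "CARD('a) = p ^ l"
    and "monomial_order prec"
    and "homogeneous f"
    and "\<forall>i\<in>{1..s}. homogeneous (g i)"
  shows
    "(\<nexists>run. run 0 = Some (div_init f) \<and> (\<forall>i. div_step p w prec s g (run i) (run (Suc i)))) \<and>
     (\<forall>X. (div_step p w prec s g)\<^sup>*\<^sup>* (Some (div_init f)) X \<longrightarrow>
       (\<exists>\<sigma>. X = Some \<sigma> \<and>
         (qpart \<sigma> \<noteq> 0 \<longrightarrow> (\<exists>Y. div_step p w prec s g X Y)) \<and>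
         (qpart \<sigma> = 0 \<longrightarrow>
            f = (\<Sum>i=1..s. hpart \<sigma> i *s g i) + rpart \<sigma> \<and>
            in_ge p w prec (in_term p w prec (rpart \<sigma>)) (in_term p w prec f) \<and>
            (\<forall>i\<in>{1..s}. in_ge p w prec (in_term p w prec (hpart \<sigma> i *s g i)) (in_term p w prec f)) \<and>
            (\<forall>i\<in>{1..s}. \<forall>t\<in>mterms (rpart \<sigma>). \<not> in_dvd (in_term p w prec (g i)) (Some t)))))"
proof -
  obtain m where "homogeneous_of m f"
    using \<open>homogeneous f\<close> homogeneous_iff by blast
  then interpret module_division p l "TYPE('a)" w prec s m f g
    using assms by unfold_locales blast+
  show ?thesis
  proof (intro conjI allI impI no_infinite_run)
    fix X assume "(div_step p w prec s g)\<^sup>*\<^sup>* (Some (div_init f)) X"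
    then obtain \<sigma> where \<sigma>: "X = Some \<sigma>" "division_invariant \<sigma>"
      using reachable_invariant by blast
    have result: "f = combination (hpart \<sigma>) + rpart \<sigma> \<and>
            in_ge p w prec (initial (rpart \<sigma>)) (initial f) \<and>
            (\<forall>i\<in>{1..s}. in_ge p w prec (initial (hpart \<sigma> i *s g i)) (initial f)) \<and>
            (\<forall>i\<in>{1..s}. \<forall>t\<in>mterms (rpart \<sigma>). \<not> in_dvd (initial (g i)) (Some t))"
      if "qpart \<sigma> = 0"
    proof -
      have pd: "partial_division (qpart \<sigma>) (hpart \<sigma>) (rpart \<sigma>)"
        and rem: "\<forall>i\<in>{1..s}. \<forall>t\<in>mterms (rpart \<sigma>). \<not> in_dvd (initial (g i)) (Some t)"
        using \<sigma>(2) unfolding division_invariant_def by blast+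
      have "f = combination (hpart \<sigma>) + rpart \<sigma>"
        using partial_division_eq[OF pd] that by simp
      then show ?thesis
        using partial_divisionD(3,4)[OF pd] rem by (intro conjI ballI in_ge_initial) blast+
    qed
    show "\<exists>\<sigma>. X = Some \<sigma> \<and>
         (qpart \<sigma> \<noteq> 0 \<longrightarrow> (\<exists>Y. div_step p w prec s g X Y)) \<and>
         (qpart \<sigma> = 0 \<longrightarrow>
            f = (\<Sum>i=1..s. hpart \<sigma> i *s g i) + rpart \<sigma> \<and>
            in_ge p w prec (in_term p w prec (rpart \<sigma>)) (in_term p w prec f) \<and>
            (\<forall>i\<in>{1..s}. in_ge p w prec (in_term p w prec (hpart \<sigma> i *s g i)) (in_term p w prec f)) \<and>
            (\<forall>i\<in>{1..s}. \<forall>t\<in>mterms (rpart \<sigma>). \<not> in_dvd (in_term p w prec (g i)) (Some t)))"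
      using \<sigma> result div_step_exists by blast
  qed
qed

end
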